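(* Let $E$ be a Banach space, $\Lambda\subset E$ open, $x_0\in\Lambda$, and $\mathcal F=\{M(x):x\in\Lambda\}$ a family of linear subspaces of $E$ (of possibly infinite dimension). If $\mathcal F$ is $c^1$ integrable at $x_0$, then (i) $M(x_0)$ is splitting in $E$, and (ii) for each complement $E_*$ of $M(x_0)$ there exist a neighborhood $V$ of $P_{M(x_0)}^{E_*}x_0$ in $M(x_0)$ and a map $\psi\in C^1(V,E_* )$ satisfying $$J(x_0,E_* )\supset\{x+\psi(x): x\in V\},\qquad (\mathrm a)$$ and $$\psi'(x)=\alpha(x+\psi(x))\ \text{ for each } x\in V,\qquad \psi\big(P_{M(x_0)}^{E_*}x_0\big)=P^{M(x_0)}_{E_*}x_0,\qquad (\mathrm b)$$ where $\psi'(x)$ is the Fréchet derivative of $\psi$ at $x$. Conversely, if (i) holds and there are a complement $E_*$ of $M(x_0)$, a neighborhood $V$ of $P_{M(x_0)}^{E_*}x_0$ in $M(x_0)$, and a map $\psi\in C^1(V,E_* )$ satisfying (a) and (b), then $\mathcal F$ is $c^1$ integrable at $x_0$.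
   Context: A direct sum $M\oplus N=E$ means that $M,N$ are closed subspaces with $M\cap N=\{0\}$ and $M+N=E$; $N$ is then called a complement of $M$, and $M$ is said to be splitting in $E$ if it has such a complement. $P_M^{N}$ denotes the projection of $E$ onto $M$ along $N$. $C^1(V,E_* )$ is the set of $c^1$ maps from the open set $V\subset M(x_0)$ to $E_*$; $B(\cdot,\cdot)$ denotes bounded linear operators. Co-tailed set: if $E=M(x_0)\oplus E_*$, then $J(x_0,E_* )=\{x\in\Lambda: M(x)\oplus E_*=E\}$. For each $x\in J(x_0,E_* )$ there is a unique operator $\alpha(x)\in B(M(x_0),E_* )$ with $M(x)=\{e+\alpha(x)e: e\in M(x_0)\}$; this is the $\alpha$ in the claim. A subset $S\subset E$ is a $c^1$ submanifold of $E$ if for each $x\in S$ there are a subspace $E_0$ splitting in $E$, a neighborhood $U$ of $x$ in $E$, and a $c^1$ diffeomorphism $\varphi$ of $U$ onto an open set $\varphi(U)\subset E$ such that $\varphi(S\cap U)$ is an open set in $E_0$. The tangent space is $T_xS=\{\dot c(0): c:(-\delta,\delta)\to S \text{ a } c^1 \text{ curve with } c(0)=x,\ \delta>0\}$. $\mathcal F$ is $c^1$ integrable at $x_0$ if there is a $c^1$ submanifold $S$ of $E$ with $x_0\in S\subset\Lambda$ and $T_xS=M(x)$ for all $x\in S$. *)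

theory Defs
  imports "HOL-Analysis.Analysis"
begin

section \<open>Direct sums and projections\<close>

definition direct_sum :: "'a::banach set \<Rightarrow> 'a set \<Rightarrow> bool" where
  "direct_sum M N \<longleftrightarrow>
     subspace M \<and> closed M \<and> subspace N \<and> closed N \<and>
     M \<inter> N = {0} \<and> {m + n | m n. m \<in> M \<and> n \<in> N} = UNIV"

definition splitting :: "'a::banach set \<Rightarrow> bool" where
  "splitting M \<longleftrightarrow> (\<exists>N. direct_sum M N)"

definition proj :: "'a::banach set \<Rightarrow> 'a set \<Rightarrow> 'a \<Rightarrow> 'a" where
  "proj M N x = (THE m. m \<in> M \<and> x - m \<in> N)"

lemma direct_sum_commute:
  assumes "direct_sum M N" shows "direct_sum N M"
proof -
  have "{m + n | m n. m \<in> N \<and> n \<in> M} = {m + n | m n. m \<in> M \<and> n \<in> N}"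
    by (metis (no_types, opaque_lifting) add.commute)
  then show ?thesis using assms unfolding direct_sum_def by auto
qed

lemma direct_sum_unique:
  assumes "direct_sum M N" "m \<in> M" "m' \<in> M" "n \<in> N" "n' \<in> N" "m + n = m' + n'"
  shows "m = m'"
proof -
  have "m - m' = n' - n" using assms(6) by (simp add: algebra_simps)
  then have "m - m' \<in> M \<inter> N"
    using assms unfolding direct_sum_def by (metis IntI subspace_diff)
  then show ?thesis using assms(1) unfolding direct_sum_def by auto
qed

lemma proj_works:
  assumes "direct_sum M N"
  shows "proj M N x \<in> M \<and> x - proj M N x \<in> N"
proof -
  have "x \<in> {m + n | m n. m \<in> M \<and> n \<in> N}"
    using assms unfolding direct_sum_def by simp
  then obtain m n where mn: "m \<in> M" "n \<in> N" "x = m + n" by blast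
  show ?thesis
    unfolding proj_def
  proof (rule theI)
    show "m \<in> M \<and> x - m \<in> N" using mn by simp
  next
    fix m' assume "m' \<in> M \<and> x - m' \<in> N"
    then show "m' = m"
      using direct_sum_unique[OF assms, of m' m "x - m'" n] mn by simp
  qed
qed


section \<open>Bounded operators and differentiable maps between subspaces\<close>

text \<open>
  The space \<open>B(F, G)\<close> for subspaces \<open>F\<close>, \<open>G\<close> of the ambient space. The operators are
  represented by extensional functions, so that equality of operators is equality of functions.
\<close>

definition bounded_ops :: "'a::real_normed_vector set \<Rightarrow> 'a set \<Rightarrow> ('a \<Rightarrow> 'a) set" where
  "bounded_ops F G =
     {A \<in> F \<rightarrow>\<^sub>E G.
        (\<forall>x\<in>F. \<forall>y\<in>F. A (x + y) = A x + A y) \<and>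
        (\<forall>r. \<forall>x\<in>F. A (r *\<^sub>R x) = r *\<^sub>R A x) \<and>
        (\<exists>K. \<forall>x\<in>F. norm (A x) \<le> K * norm x)}"

definition op_norm_on :: "'a::real_normed_vector set \<Rightarrow> ('a \<Rightarrow> 'a) \<Rightarrow> real" where
  "op_norm_on F A = (SUP e\<in>{e \<in> F. norm e \<le> 1}. norm (A e))"

text \<open>
  Frechet derivative, at an interior point \<open>x\<close> of the domain relative to \<open>F\<close>, of a map from a
  part of \<open>F\<close> to \<open>G\<close>. The library's \<open>has_derivative\<close> is not used here because it takes
  derivatives defined on the whole ambient space, which are not determined off \<open>F\<close>.
\<close>

definition has_derivative_rel ::
    "'a::real_normed_vector set \<Rightarrow> 'a set \<Rightarrow> ('a \<Rightarrow> 'a) \<Rightarrow> ('a \<Rightarrow> 'a) \<Rightarrow> 'a \<Rightarrow> bool" where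
  "has_derivative_rel F G f D x \<longleftrightarrow>
     D \<in> bounded_ops F G \<and>
     ((\<lambda>h. norm (f (x + h) - f x - D h) / norm h) \<longlongrightarrow> 0) (at 0 within F)"

text \<open>\<open>C\<^sup>1(V, G)\<close> for \<open>V\<close> open in the subspace \<open>F\<close>; values of the maps outside \<open>V\<close> are irrelevant.\<close>

definition C1_maps :: "'a::real_normed_vector set \<Rightarrow> 'a set \<Rightarrow> 'a set \<Rightarrow> ('a \<Rightarrow> 'a) set" where
  "C1_maps F V G =
     {f. f ` V \<subseteq> G \<and>
         (\<exists>D. (\<forall>x\<in>V. has_derivative_rel F G f (D x) x) \<and>
              (\<forall>x\<in>V. ((\<lambda>y. op_norm_on F (\<lambda>e. D y e - D x e)) \<longlongrightarrow> 0) (at x within V)))}"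


section \<open>Submanifolds and integrability\<close>

definition C1_on :: "'a::real_normed_vector set \<Rightarrow> ('a \<Rightarrow> 'a) \<Rightarrow> bool" where
  "C1_on U f \<longleftrightarrow>
     (\<exists>f' :: 'a \<Rightarrow> 'a \<Rightarrow>\<^sub>L 'a.
        (\<forall>x\<in>U. (f has_derivative blinfun_apply (f' x)) (at x)) \<and> continuous_on U f')"

definition C1_diffeo :: "'a::real_normed_vector set \<Rightarrow> 'a set \<Rightarrow> ('a \<Rightarrow> 'a) \<Rightarrow> bool" where
  "C1_diffeo U W f \<longleftrightarrow>
     open U \<and> open W \<and> (\<exists>g. homeomorphism U W f g \<and> C1_on U f \<and> C1_on W g)"

definition C1_submanifold :: "'a::banach set \<Rightarrow> bool" where
  "C1_submanifold S \<longleftrightarrow>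
     (\<forall>x\<in>S. \<exists>E0 U \<phi>. splitting E0 \<and> x \<in> U \<and> C1_diffeo U (\<phi> ` U) \<phi> \<and>
        openin (top_of_set E0) (\<phi> ` (S \<inter> U)))"

definition tangent_space :: "'a::real_normed_vector set \<Rightarrow> 'a \<Rightarrow> 'a set" where
  "tangent_space S x =
     {v. \<exists>\<delta>>0. \<exists>c :: real \<Rightarrow> 'a.
        c C1_differentiable_on {-\<delta><..<\<delta>} \<and> c ` {-\<delta><..<\<delta>} \<subseteq> S \<and> c 0 = x \<and>
        (c has_vector_derivative v) (at 0)}"

definition C1_integrable_at :: "('a::banach \<Rightarrow> 'a set) \<Rightarrow> 'a set \<Rightarrow> 'a \<Rightarrow> bool" where
  "C1_integrable_at M \<Lambda> x0 \<longleftrightarrow>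
     (\<exists>S. C1_submanifold S \<and> x0 \<in> S \<and> S \<subseteq> \<Lambda> \<and> (\<forall>x\<in>S. tangent_space S x = M x))"


section \<open>Co-tailed sets\<close>

text \<open>
  \<open>cotailed M \<Lambda> N\<close> is \<open>J(x0, N)\<close>; the point \<open>x0\<close> enters only through the standing assumption that
  \<open>N\<close> is a complement of \<open>M x0\<close>.
\<close>

definition cotailed :: "('a::banach \<Rightarrow> 'a set) \<Rightarrow> 'a set \<Rightarrow> 'a set \<Rightarrow> 'a set" where
  "cotailed M \<Lambda> N = {x \<in> \<Lambda>. direct_sum (M x) N}"

definition alpha :: "('a::banach \<Rightarrow> 'a set) \<Rightarrow> 'a \<Rightarrow> 'a set \<Rightarrow> 'a \<Rightarrow> 'a \<Rightarrow> 'a" where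
  "alpha M x0 N x =
     (THE A. A \<in> bounded_ops (M x0) N \<and> M x = {e + A e | e. e \<in> M x0})"

lemma alpha_unique:
  assumes "direct_sum (M x0) N"
    and A: "A \<in> bounded_ops (M x0) N" "M x = {e + A e | e. e \<in> M x0}"
    and B: "B \<in> bounded_ops (M x0) N" "M x = {e + B e | e. e \<in> M x0}"
  shows "A = B"
proof (rule PiE_ext[where k = "M x0" and s = "\<lambda>_. N"])
  show "A \<in> M x0 \<rightarrow>\<^sub>E N" "B \<in> M x0 \<rightarrow>\<^sub>E N"
    using A(1) B(1) by (simp_all add: bounded_ops_def)
next
  fix e assume e: "e \<in> M x0"
  then have "e + A e \<in> {e + B e | e. e \<in> M x0}" using A(2) B(2) by blast
  then obtain e' where e': "e' \<in> M x0" "e + A e = e' + B e'" by blast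
  have "A e \<in> N" "B e' \<in> N" using A(1) B(1) e e' by (auto simp: bounded_ops_def)
  then have "e = e'" using direct_sum_unique[OF assms(1) e e'(1)] e'(2) by blast
  then show "A e = B e" using e' by simp
qed

end

theory Submission
  imports Defs
begin

text \<open>
  Both directions come from straightening the integral manifold over \<open>M x0\<close>.

  If \<open>S\<close> is an integral manifold through \<open>x0\<close>, a chart \<open>\<phi>\<close> flattens \<open>S\<close> into a splitting subspace
  \<open>E0\<close>, and its derivative at a point of \<open>S\<close> carries the tangent space there onto \<open>E0\<close>
  (\<open>tangent_space_in_chart\<close>). In particular \<open>M x0\<close> splits (\<open>tangent_space_splitting\<close>). Given a
  complement \<open>N\<close> with projection \<open>P\<close> onto \<open>M x0\<close>, the map
  \<open>H y = P y + (id - P) (L\<^sup>-\<^sup>1 (\<phi> y))\<close>, where \<open>L\<close> is the derivative of \<open>\<phi>\<close> at \<open>x0\<close>, has identity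
  derivative at \<open>x0\<close>, does not change the component in \<open>M x0\<close>, and near \<open>x0\<close> takes values in
  \<open>M x0\<close> exactly on \<open>S\<close>. Its local inverse therefore presents \<open>S\<close> as the graph of a map \<open>\<psi>\<close> from
  \<open>M x0\<close> to \<open>N\<close>, and the tangent space of a graph is the graph of the derivative: this is the
  equation \<open>\<psi>' = \<alpha>\<close> (\<open>integrable_imp_graph\<close>).

  Conversely the graph of a solution \<open>\<psi>\<close> is flattened by the shear \<open>y - \<psi> (P y)\<close>, and the equation
  says that its tangent spaces are the given ones (\<open>graph_imp_integrable\<close>).

  Two general facts about Banach spaces carry the analysis. Projections of closed direct sums are
  bounded (\<open>bounded_linear_proj\<close>, by the closed graph theorem); this makes \<open>P\<close> smooth and the
  operators \<open>\<alpha>\<close> bounded. A continuously differentiable map with identity derivative at a point has a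
  continuously differentiable local inverse (\<open>inverse_function_theorem_at_identity\<close>).
\<close>

section \<open>The closed graph theorem and topological direct sums\<close>

text \<open>
  The sets of points where \<open>P\<close> is bounded by \<open>n\<close> cover the space, so by Baire the closure of one of
  them has an interior point, and by symmetry and convexity it contains a ball around \<open>0\<close>. Hence
  every \<open>x\<close> in that ball is approximated by some \<open>y\<close> with \<open>P y\<close> bounded by \<open>n\<close>; approximating the
  remainders again at geometrically decreasing scales writes \<open>x\<close> as a series along which \<open>P\<close>
  converges absolutely, and the closed graph identifies the sum of the images with \<open>P x\<close>.
\<close>

lemma bounded_linear_closed_graph:
  fixes P :: "'a::banach \<Rightarrow> 'b::banach"
  assumes "linear P"
    and graph: "\<And>X x y. X \<longlonglongrightarrow> x \<Longrightarrow> (\<lambda>n. P (X n)) \<longlonglongrightarrow> y \<Longrightarrow> P x = y"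
  shows "bounded_linear P"
proof -
  interpret linear P by fact
  define B where "B n = {x. norm (P x) \<le> real n}" for n
  have "\<exists>n. interior (closure (B n)) \<noteq> {}"
  proof (rule ccontr)
    assume "\<not> ?thesis"
    then have "euclidean interior_of (\<Union>n. closure (B n)) = {}"
      by (intro Baire_category_alt) (auto simp: completely_metrizable_space_euclidean)
    moreover have "(\<Union>n. closure (B n)) = UNIV"
      using real_arch_simple closure_subset by (fastforce simp: B_def)
    ultimately show False by simp
  qed
  then obtain n a where "a \<in> interior (closure (B n))" by blast
  then obtain r where r: "r > 0" "ball a r \<subseteq> closure (B n)"
    unfolding mem_interior by blast
  have approx: "\<exists>y. norm (P y) \<le> n \<and> norm (x - y) < d" if x: "norm x < r" and "d > 0" for x d
  proof -
    have "a + x \<in> closure (B n)" "a - x \<in> closure (B n)"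
      using r(2) x by (auto simp: subset_iff dist_norm)
    then obtain y z where yz: "norm (P y) \<le> n" "dist y (a + x) < d" "norm (P z) \<le> n" "dist z (a - x) < d"
      unfolding closure_approachable B_def using \<open>d > 0\<close> by blast
    \<comment> \<open>\<open>x\<close> is half the difference of \<open>a + x\<close> and \<open>a - x\<close>\<close>
    let ?y = "(1/2) *\<^sub>R (y - z)"
    have "norm (P ?y) \<le> n"
      using norm_triangle_ineq4[of "P y" "P z"] yz by (simp add: scale diff)
    moreover have "x - ?y = (1/2) *\<^sub>R ((a + x - y) - (a - x - z))"
      by (simp add: algebra_simps flip: scaleR_add_left)
    then have "norm (x - ?y) \<le> (norm (a + x - y) + norm (a - x - z)) / 2"
      using norm_triangle_ineq4[of "a + x - y" "a - x - z"] by simp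
    ultimately show ?thesis
      using yz(2,4) by (intro exI[of _ ?y]) (simp add: dist_norm norm_minus_commute)
  qed
  have step: "\<exists>y. norm (P y) \<le> n * (1/2)^k \<and> norm (x - y) < r * (1/2)^Suc k"
    if x: "norm x < r * (1/2)^k" for x k
  proof -
    have "norm ((2^k) *\<^sub>R x) < r" using x by (simp add: field_simps power_divide)
    from approx[OF this, of "r/2"] r obtain y
      where y: "norm (P y) \<le> n" "norm ((2^k) *\<^sub>R x - y) < r/2" by auto
    have "x - ((1/2)^k) *\<^sub>R y = ((1/2)^k) *\<^sub>R ((2^k) *\<^sub>R x - y)"
      by (simp add: scaleR_diff_right flip: power_mult_distrib)
    then have "norm (x - ((1/2)^k) *\<^sub>R y) = (1/2)^k * norm ((2^k) *\<^sub>R x - y)"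
      by (simp only: norm_scaleR) simp
    also have "\<dots> < (1/2)^k * (r/2)" using y(2) by (intro mult_strict_left_mono) simp_all
    finally have "norm (x - ((1/2)^k) *\<^sub>R y) < r * (1/2)^Suc k" by (simp add: mult.commute)
    moreover have "norm (P (((1/2)^k) *\<^sub>R y)) \<le> n * (1/2)^k"
      using y(1) by (simp add: scale power_divide field_simps)
    ultimately show ?thesis by blast
  qed
  have bound: "norm (P x) \<le> 2 * n" if x: "norm x < r" for x
  proof -
    define f where "f k z = (SOME y. norm (P y) \<le> n * (1/2)^k \<and> norm (z - y) < r * (1/2)^Suc k)" for k z
    have f: "norm (P (f k z)) \<le> n * (1/2)^k \<and> norm (z - f k z) < r * (1/2)^Suc k"
      if "norm z < r * (1/2)^k" for k z
      using someI_ex[OF step[OF that]] by (simp only: f_def)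
    \<comment> \<open>\<open>z k\<close> is the remainder after \<open>k\<close> approximations, \<open>y k\<close> the next approximation\<close>
    define z where "z = rec_nat x (\<lambda>k w. w - f k w)"
    have z0: "z 0 = x" and zS: "\<And>k. z (Suc k) = z k - f k (z k)"
      by (simp_all add: z_def)
    have zb: "norm (z k) < r * (1/2)^k" for k
      by (induction k) (use x f zS z0 in auto)
    define y where "y k = f k (z k)" for k
    have py: "norm (P (y k)) \<le> n * (1/2)^k" for k using f[OF zb] by (simp add: y_def)
    have ps: "(\<Sum>k<m. y k) = x - z m" for m
      by (induction m) (simp_all add: z0 zS y_def)
    have "(\<lambda>k. r * (1/2)^k) \<longlonglongrightarrow> 0"
      by (intro tendsto_eq_intros LIMSEQ_power_zero) auto
    then have "z \<longlonglongrightarrow> 0"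
      by (rule Lim_null_comparison[rotated]) (use zb in \<open>auto intro!: always_eventually less_imp_le\<close>)
    then have lim: "(\<lambda>m. \<Sum>k<m. y k) \<longlonglongrightarrow> x"
      unfolding ps by (auto intro: tendsto_eq_intros)
    have gs: "(\<lambda>k. real n * (1/2)^k) sums (2 * n)"
      using sums_mult[OF geometric_sums[of "1/2::real"], of n] by (simp add: mult.commute)
    have "summable (\<lambda>k. P (y k))"
      by (rule summable_comparison_test'[of "\<lambda>k. n * (1/2)^k" 0])
        (use py gs in \<open>auto simp: sums_iff\<close>)
    then have "(\<lambda>m. P (\<Sum>k<m. y k)) \<longlonglongrightarrow> (\<Sum>k. P (y k))"
      unfolding sum by (rule summable_LIMSEQ)
    from graph[OF lim this] have "P x = (\<Sum>k. P (y k))" .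
    moreover have "norm (\<Sum>k. P (y k)) \<le> 2 * n"
      using suminf_le_const py gs norm_suminf_le[of "\<lambda>k. P (y k)" "\<lambda>k. n * (1/2)^k"] by (auto simp: sums_iff)
    ultimately show ?thesis by simp
  qed
  have "norm (P x) \<le> norm x * (4 * n / r)" for x
  proof (cases "x = 0")
    case False
    let ?c = "r / (2 * norm x)"
    have c: "?c > 0" using False r by simp
    have "norm (?c *\<^sub>R x) < r" using False r by simp
    from bound[OF this] r have "?c * norm (P x) \<le> 2 * n" by (simp add: scale)
    then show ?thesis using False r by (simp add: field_simps)
  qed (simp add: zero)
  then show ?thesis
    by unfold_locales (blast)
qed

lemma direct_sum_unique_proj:
  assumes "direct_sum M N" "m \<in> M" "x - m \<in> N"
  shows "proj M N x = m"
  using direct_sum_unique[OF assms(1), of "proj M N x" m "x - proj M N x" "x - m"]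
    proj_works[OF assms(1), of x] assms by simp

text \<open>
  Closedness of both summands makes the graph of the projection closed. All later arguments rest on
  this continuity, since a direct sum is only assumed to be algebraic with closed summands.
\<close>

lemma bounded_linear_proj:
  assumes ds: "direct_sum M N"
  shows "bounded_linear (proj M N)"
proof (rule bounded_linear_closed_graph)
  have sub: "subspace M" "subspace N" and cl: "closed M" "closed N"
    using ds by (auto simp: direct_sum_def)
  note pw = proj_works[OF ds]
  show "linear (proj M N)"
  proof (rule linearI)
    fix x y
    have "x + y - (proj M N x + proj M N y) = (x - proj M N x) + (y - proj M N y)" by simp
    then show "proj M N (x + y) = proj M N x + proj M N y"
      using pw sub by (metis (no_types) direct_sum_unique_proj[OF ds] subspace_add)
  next
    fix r x
    have "r *\<^sub>R x - r *\<^sub>R proj M N x = r *\<^sub>R (x - proj M N x)" by (simp add: scaleR_diff_right)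
    then show "proj M N (r *\<^sub>R x) = r *\<^sub>R proj M N x"
      using pw sub by (metis (no_types) direct_sum_unique_proj[OF ds] subspace_scale)
  qed
  fix X x y assume X: "X \<longlonglongrightarrow> x" "(\<lambda>n. proj M N (X n)) \<longlonglongrightarrow> y"
  show "proj M N x = y"
  proof (rule direct_sum_unique_proj[OF ds])
    show "y \<in> M" using closed_sequentially[OF cl(1) _ X(2)] pw by blast
    show "x - y \<in> N" using closed_sequentially[OF cl(2) _ tendsto_diff[OF X]] pw by blast
  qed
qed

lemma proj_complement:
  assumes "direct_sum M N" shows "proj N M x = x - proj M N x"
  using proj_works[OF assms, of x]
  by (intro direct_sum_unique_proj[OF direct_sum_commute[OF assms]]) simp_all

lemma proj_on_range:
  assumes "direct_sum M N" "m \<in> M" shows "proj M N m = m"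
  using assms by (intro direct_sum_unique_proj) (auto simp: direct_sum_def subspace_0)

lemma proj_on_kernel:
  assumes "direct_sum M N" "n \<in> N" shows "proj M N n = 0"
  using assms by (intro direct_sum_unique_proj) (auto simp: direct_sum_def subspace_0)

lemma direct_sum_vimage:
  assumes ds: "direct_sum A B" and L: "bounded_linear L" "bij L"
  shows "direct_sum (L -` A) (L -` B)"
proof -
  interpret bounded_linear L by fact
  have closed: "closed (L -` C)" if "closed C" for C
    by (rule closed_vimage[OF that]) (rule linear_continuous_on[OF L(1)])
  have inj: "L x = L y \<Longrightarrow> x = y" for x y using bij_is_inj[OF L(2)] by (rule injD)
  have "x \<in> {m + n |m n. m \<in> L -` A \<and> n \<in> L -` B}" for x
  proof -
    obtain a where a: "L a = proj A B (L x)" using bij_is_surj[OF L(2)] by (metis surj_def)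
    have "x = a + (x - a)" "a \<in> L -` A" "x - a \<in> L -` B"
      using proj_works[OF ds, of "L x"] by (simp_all add: a diff)
    then show ?thesis by blast
  qed
  moreover have "L -` A \<inter> L -` B = {0}"
  proof -
    have "L x = 0 \<longleftrightarrow> x = 0" for x using inj[of x 0] zero by auto
    then show ?thesis using ds by (auto simp: direct_sum_def)
  qed
  ultimately show ?thesis
    using ds closed linear_subspace_vimage[OF linear_axioms] unfolding direct_sum_def by auto
qed

section \<open>The inverse function theorem at a point with identity derivative\<close>

text \<open>
  Solving \<open>A u = z\<close> is the fixed point problem \<open>u = z - (A u - u)\<close>, a contraction with factor \<open>1/2\<close>.
  The lower bound on \<open>A\<close> says that the inverse has norm at most \<open>2\<close>.
\<close>

lemma near_identity_bij:
  fixes A :: "'a::banach \<Rightarrow>\<^sub>L 'a"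
  assumes near: "norm (A - id_blinfun) \<le> 1/2"
  shows "bij A" and "norm h \<le> 2 * norm (A h)"
proof -
  have diff: "norm (A u - u) \<le> norm u / 2" for u
    using norm_blinfun[of "A - id_blinfun" u] mult_right_mono[OF near, of "norm u"]
    by (simp add: blinfun.diff_left)
  have low: "norm h \<le> 2 * norm (A h)" for h
    using diff[of h] norm_triangle_ineq3[of "A h" h] by simp
  then show "norm h \<le> 2 * norm (A h)" .
  have "inj A"
  proof (rule injI)
    fix u v assume "A u = A v"
    then show "u = v" using low[of "u - v"] by (simp add: blinfun.diff_right)
  qed
  moreover have "\<exists>u. A u = z" for z
  proof -
    have "\<exists>!u\<in>UNIV. z - (A u - u) = u"
    proof (rule Banach_fix[where c = "1/2"])
      fix u v :: 'a
      have "dist (z - (A u - u)) (z - (A v - v)) = norm (A (u - v) - (u - v))"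
        by (simp add: dist_norm blinfun.diff_right norm_minus_commute algebra_simps)
      then show "dist (z - (A u - u)) (z - (A v - v)) \<le> 1/2 * dist u v"
        using diff[of "u - v"] by (simp add: dist_norm)
    qed (auto simp: complete_UNIV)
    then show ?thesis by (auto simp: algebra_simps)
  qed
  ultimately show "bij A" by (metis bijI surj_def)
qed

text \<open>
  On a small ball \<open>H - id\<close> is Lipschitz with constant \<open>1/2\<close>, so \<open>H y = z\<close> is solved by contraction
  and the solution \<open>K z\<close> depends Lipschitz-continuously on \<open>z\<close>. The derivative of \<open>K\<close> at \<open>z\<close> is the
  inverse of \<open>H' (K z)\<close>, whose norm stays below \<open>2\<close>; the identity
  \<open>A\<^sup>-\<^sup>1 - B\<^sup>-\<^sup>1 = A\<^sup>-\<^sup>1 (B - A) B\<^sup>-\<^sup>1\<close> then makes it continuous in \<open>z\<close>. Normalizing the derivative at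
  \<open>x0\<close> to the identity costs nothing in the application below, where \<open>H\<close> is built with that property.
\<close>

lemma inverse_function_theorem_at_identity:
  fixes H :: "'a::banach \<Rightarrow> 'a" and H' :: "'a \<Rightarrow> 'a \<Rightarrow>\<^sub>L 'a"
  assumes "open U" "x0 \<in> U"
    and deriv: "\<And>x. x \<in> U \<Longrightarrow> (H has_derivative blinfun_apply (H' x)) (at x)"
    and cont: "continuous_on U H'"
    and id: "H' x0 = id_blinfun"
  obtains T K K' where "open T" "H x0 \<in> T" "K (H x0) = x0"
    "\<And>z. z \<in> T \<Longrightarrow> K z \<in> U" "\<And>z. z \<in> T \<Longrightarrow> H (K z) = z"
    "\<And>z. z \<in> T \<Longrightarrow> bij (H' (K z))"
    "\<And>z. z \<in> T \<Longrightarrow> (K has_derivative blinfun_apply (K' z)) (at z)"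
    "\<And>z h. z \<in> T \<Longrightarrow> H' (K z) (K' z h) = h"
    "continuous_on T (K' :: 'a \<Rightarrow> 'a \<Rightarrow>\<^sub>L 'a)"
proof -
  have "continuous (at x0) H'" using cont \<open>open U\<close> \<open>x0 \<in> U\<close> continuous_on_eq_continuous_at by blast
  then obtain d where d: "d > 0" "\<And>x. dist x x0 < d \<Longrightarrow> dist (H' x) (H' x0) < 1/2"
    unfolding continuous_at_eps_delta by (metis half_gt_zero zero_less_one)
  obtain e where e: "e > 0" "cball x0 e \<subseteq> U" using \<open>open U\<close> \<open>x0 \<in> U\<close> open_contains_cball by blast
  define r where "r = min (d/2) e"
  have r: "r > 0" "cball x0 r \<subseteq> U" using d(1) e by (auto simp: r_def)
  have near: "norm (H' x - id_blinfun) \<le> 1/2" if "x \<in> cball x0 r" for x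
    using d(2)[of x] that d(1) unfolding id r_def by (simp add: dist_norm norm_minus_commute)
  have lip: "norm ((H x - x) - (H y - y)) \<le> 1/2 * norm (x - y)"
    if "x \<in> cball x0 r" "y \<in> cball x0 r" for x y
  proof (rule differentiable_bound[OF convex_cball _ _ that])
    fix w assume w: "w \<in> cball x0 r"
    then have "(H has_derivative blinfun_apply (H' w)) (at w within cball x0 r)"
      using deriv r has_derivative_at_withinI by blast
    then show "((\<lambda>w. H w - w) has_derivative blinfun_apply (H' w - id_blinfun)) (at w within cball x0 r)"
      by (auto intro!: derivative_eq_intros simp: blinfun.diff_left)
    show "onorm (blinfun_apply (H' w - id_blinfun)) \<le> 1/2" using near[OF w] by (simp add: norm_blinfun.rep_eq)
  qed
  define T where "T = ball (H x0) (r/2)"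
  define K where "K z = (SOME y. y \<in> cball x0 r \<and> H y = z)" for z
  have expand: "norm (x - y) \<le> 2 * norm (H x - H y)" if "x \<in> cball x0 r" "y \<in> cball x0 r" for x y
  proof -
    have "norm (x - y) \<le> norm (H x - H y) + norm ((H x - x) - (H y - y))"
      using norm_triangle_ineq4[of "H x - H y" "(H x - x) - (H y - y)"] by (simp add: algebra_simps)
    then show ?thesis using lip[OF that] by simp
  qed
  have K: "K z \<in> cball x0 r \<and> H (K z) = z" if z: "z \<in> T" for z
  proof -
    have "\<exists>!y\<in>cball x0 r. z - (H y - y) = y"
    proof (rule Banach_fix[where c = "1/2"])
      show "complete (cball x0 r)" by (simp add: complete_eq_closed)
      show "cball x0 r \<noteq> {}" using r by simp
      show "(\<lambda>y. z - (H y - y)) ` cball x0 r \<subseteq> cball x0 r"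
      proof (rule image_subsetI)
        fix y assume y: "y \<in> cball x0 r"
        have "x0 \<in> cball x0 r" using r by simp
        from lip[OF y this] y have "norm ((H y - y) - (H x0 - x0)) \<le> r/2"
          by (simp add: dist_norm norm_minus_commute)
        moreover have "norm (z - H x0) < r/2" using z by (simp add: T_def dist_norm norm_minus_commute)
        ultimately have "norm ((z - H x0) - ((H y - y) - (H x0 - x0))) \<le> r"
          using norm_triangle_ineq4[of "z - H x0" "(H y - y) - (H x0 - x0)"] by linarith
        then show "z - (H y - y) \<in> cball x0 r"
          by (simp add: dist_norm norm_minus_commute algebra_simps)
      qed
      fix x y assume "x \<in> cball x0 r" "y \<in> cball x0 r"
      note lip[OF this]
      moreover have "(z - (H x - x)) - (z - (H y - y)) = - ((H x - x) - (H y - y))" by simp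
      ultimately show "dist (z - (H x - x)) (z - (H y - y)) \<le> 1/2 * dist x y"
        by (simp only: dist_norm norm_minus_cancel)
    qed simp_all
    then have "\<exists>y. y \<in> cball x0 r \<and> H y = z" by (auto simp: algebra_simps)
    then show ?thesis unfolding K_def by (rule someI_ex)
  qed
  have T: "open T" "H x0 \<in> T" using r by (simp_all add: T_def)
  have contK: "continuous_on T K"
  proof (rule lipschitz_on_continuous_on[where L = 2], rule lipschitz_onI)
    fix z w assume "z \<in> T" "w \<in> T"
    then show "dist (K z) (K w) \<le> 2 * dist z w"
      using expand[of "K z" "K w"] K[of z] K[of w] by (simp only: dist_norm)
  qed simp
  have Kx0: "K (H x0) = x0" using expand[of "K (H x0)" x0] K[OF T(2)] r by simp
  define K' where "K' z = Blinfun (inv (H' (K z)))" for z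
  have bij: "bij (H' (K z))" if "z \<in> T" for z using near_identity_bij(1) near K that by blast
  have right: "H' (K z) (inv (H' (K z)) h) = h" if "z \<in> T" for z h
    using bij[OF that] by (simp add: bij_is_surj surj_f_inv_f)
  have left: "inv (H' (K z)) (H' (K z) h) = h" if "z \<in> T" for z h
    using bij[OF that] by (simp add: bij_is_inj)
  have inv_bound: "norm (inv (H' (K z)) h) \<le> 2 * norm h" if "z \<in> T" for z h
    using near_identity_bij(2)[OF near, of "K z" "inv (H' (K z)) h"] K[OF that] right[OF that] by simp
  have bl: "bounded_linear (inv (H' (K z)))" if z: "z \<in> T" for z
  proof (rule bounded_linear_intro[where K = 2])
    fix u v c
    show "inv (H' (K z)) (u + v) = inv (H' (K z)) u + inv (H' (K z)) v"
      using left[OF z, of "inv (H' (K z)) u + inv (H' (K z)) v"] right[OF z] by (simp add: blinfun.add_right)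
    show "inv (H' (K z)) (c *\<^sub>R u) = c *\<^sub>R inv (H' (K z)) u"
      using left[OF z, of "c *\<^sub>R inv (H' (K z)) u"] right[OF z] by (simp add: blinfun.scaleR_right)
    show "norm (inv (H' (K z)) u) \<le> norm u * 2" using inv_bound[OF z, of u] by simp
  qed
  have K': "blinfun_apply (K' z) = inv (H' (K z))" if "z \<in> T" for z
    using bl[OF that] by (simp add: K'_def bounded_linear_Blinfun_apply)
  have dK: "(K has_derivative blinfun_apply (K' z)) (at z)" if z: "z \<in> T" for z
  proof (rule has_derivative_inverse_basic[where f = H and f' = "H' (K z)" and T = T])
    show "(H has_derivative H' (K z)) (at (K z))" using deriv K z r by blast
    show "blinfun_apply (K' z) \<circ> blinfun_apply (H' (K z)) = id" using left[OF z] K'[OF z] by auto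
    show "continuous (at z) K" using contK T(1) z continuous_on_eq_continuous_at by blast
  qed (use T z K blinfun.bounded_linear_right in auto)
  have resolvent: "dist (K' z) (K' w) \<le> 4 * dist (H' (K z)) (H' (K w))" if z: "z \<in> T" and w: "w \<in> T" for z w
    unfolding dist_norm
  proof (rule norm_blinfun_bound)
    fix h
    have "(K' z - K' w) h = K' z (H' (K w) (K' w h) - H' (K z) (K' w h))"
      using K'[OF z] K'[OF w] right[OF w] left[OF z] blinfun.diff_right[of "K' z"] by (simp add: blinfun.diff_left)
    also have "norm \<dots> \<le> 2 * norm ((H' (K w) - H' (K z)) (K' w h))"
      using inv_bound[OF z] by (simp add: K'[OF z] blinfun.diff_left)
    also have "\<dots> \<le> 2 * (norm (H' (K w) - H' (K z)) * norm (K' w h))"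
      by (intro mult_left_mono norm_blinfun) simp
    also have "\<dots> \<le> 2 * (norm (H' (K w) - H' (K z)) * (2 * norm h))"
      using inv_bound[OF w] by (intro mult_left_mono) (simp_all add: K'[OF w])
    finally show "norm ((K' z - K' w) h) \<le> 4 * norm (H' (K z) - H' (K w)) * norm h"
      by (simp add: norm_minus_commute)
  qed simp
  have contHK: "continuous_on T (\<lambda>z. H' (K z))"
    using continuous_on_compose2[OF cont contK] K r by blast
  have contK': "continuous_on T K'"
    unfolding continuous_on_iff
  proof (intro ballI allI impI)
    fix z and \<epsilon> :: real assume z: "z \<in> T" and "\<epsilon> > 0"
    then obtain \<delta> where "\<delta> > 0" "\<forall>w\<in>T. dist w z < \<delta> \<longrightarrow> dist (H' (K w)) (H' (K z)) < \<epsilon> / 4"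
      using contHK unfolding continuous_on_iff by (metis zero_less_divide_iff zero_less_numeral)
    then show "\<exists>\<delta>>0. \<forall>w\<in>T. dist w z < \<delta> \<longrightarrow> dist (K' w) (K' z) < \<epsilon>"
      using resolvent[OF _ z] by (intro exI[of _ \<delta>]) fastforce
  qed
  show thesis
    by (rule that[of T K K']) (use T Kx0 K r bij dK right K' contK' in auto)
qed

section \<open>Tangent spaces in a chart\<close>

lemma homeomorphism_derivatives_inverse:
  fixes f :: "'a::real_normed_vector \<Rightarrow> 'b::real_normed_vector"
  assumes hom: "homeomorphism U W f g" and "open U" "open W" "x \<in> U"
    and f: "(f has_derivative f') (at x)" and g: "(g has_derivative g') (at (f x))"
  shows "g' (f' v) = v" and "f' (g' w) = w"
proof -
  have gf: "\<And>u. u \<in> U \<Longrightarrow> g (f u) = u" and fg: "\<And>w. w \<in> W \<Longrightarrow> f (g w) = w" and "f x \<in> W"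
    using hom \<open>x \<in> U\<close> by (auto simp: homeomorphism_def)
  have "((\<lambda>u. g (f u)) has_derivative (\<lambda>v. g' (f' v))) (at x)"
    using has_derivative_compose[OF f g] by simp
  then have "((\<lambda>u. u) has_derivative (\<lambda>v. g' (f' v))) (at x)"
    by (rule has_derivative_transform_within_open[OF _ \<open>open U\<close> \<open>x \<in> U\<close> gf])
  then have "(\<lambda>v. g' (f' v)) = (\<lambda>v. v)" using has_derivative_unique has_derivative_ident by blast
  then show "g' (f' v) = v" by metis
  have "((\<lambda>w. f (g w)) has_derivative (\<lambda>v. f' (g' v))) (at (f x))"
    using has_derivative_compose[OF g, of f f'] f gf[OF \<open>x \<in> U\<close>] by simp
  then have "((\<lambda>w. w) has_derivative (\<lambda>v. f' (g' v))) (at (f x))"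
    by (rule has_derivative_transform_within_open[OF _ \<open>open W\<close> \<open>f x \<in> W\<close> fg])
  then have "(\<lambda>v. f' (g' v)) = (\<lambda>v. v)" using has_derivative_unique has_derivative_ident by blast
  then show "f' (g' w) = w" by metis
qed

text \<open>
  A curve in \<open>S\<close> is mapped by the chart into \<open>E0\<close>, and so are its difference quotients; since \<open>E0\<close> is
  closed, the limit stays there. Conversely a direction in \<open>E0\<close> is the velocity of a straight segment,
  which lies in the chart image because the latter is open in \<open>E0\<close>; pulling it back gives a curve in
  \<open>S\<close>.
\<close>

lemma tangent_space_in_chart:
  fixes \<phi> :: "'a::banach \<Rightarrow> 'a"
  assumes diffeo: "C1_diffeo U W \<phi>" and x: "x \<in> S" "x \<in> U"
    and E0: "subspace E0" "closed E0" "openin (top_of_set E0) (\<phi> ` (S \<inter> U))"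
    and D: "(\<phi> has_derivative D) (at x)"
  shows "tangent_space S x = {v. D v \<in> E0}"
proof -
  obtain g g' where UW: "open U" "open W" and hom: "homeomorphism U W \<phi> g"
    and g: "\<And>w. w \<in> W \<Longrightarrow> (g has_derivative blinfun_apply (g' w)) (at w)" and g': "continuous_on W g'"
    using diffeo unfolding C1_diffeo_def C1_on_def by blast
  have W: "\<phi> x \<in> W" using hom x by (auto simp: homeomorphism_def)
  have g\<phi>: "g (\<phi> u) = u" if "u \<in> U" for u using hom that by (auto simp: homeomorphism_def)
  note inv = homeomorphism_derivatives_inverse[OF hom UW x(2) D g[OF W]]
  show ?thesis
  proof (intro equalityI subsetI CollectI)
    fix v assume "v \<in> tangent_space S x"
    then obtain \<delta> c where \<delta>: "\<delta> > 0" "c ` {-\<delta><..<\<delta>} \<subseteq> S" "c 0 = x"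
      and c: "(c has_vector_derivative v) (at 0)"
      unfolding tangent_space_def by blast
    have "((\<lambda>t. \<phi> (c t)) has_vector_derivative D v) (at 0)"
      using vector_derivative_diff_chain_within[OF c, of \<phi> D] D \<delta>(3) has_derivative_at_withinI
      by (auto simp: o_def)
    then have "((\<lambda>t. norm (\<phi> (c t) - \<phi> (c 0) - t *\<^sub>R D v) / norm t) \<longlongrightarrow> 0) (at 0)"
      by (simp add: has_vector_derivative_def has_derivative_at)
    then have "((\<lambda>t. norm ((\<phi> (c t) - \<phi> (c 0)) /\<^sub>R t - D v)) \<longlongrightarrow> 0) (at 0)"
    proof (rule Lim_transform_eventually)
      have "norm (w - t *\<^sub>R D v) / norm t = norm (w /\<^sub>R t - D v)" if "t \<noteq> 0" for t and w :: 'a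
      proof -
        have "w /\<^sub>R t - D v = (w - t *\<^sub>R D v) /\<^sub>R t" using that by (simp add: scaleR_diff_right)
        then show ?thesis by (simp add: divide_inverse_commute)
      qed
      then show "\<forall>\<^sub>F t in at 0. norm (\<phi> (c t) - \<phi> (c 0) - t *\<^sub>R D v) / norm t = norm ((\<phi> (c t) - \<phi> (c 0)) /\<^sub>R t - D v)"
        by (simp add: eventually_at_filter)
    qed
    then have lim: "((\<lambda>t. (\<phi> (c t) - \<phi> (c 0)) /\<^sub>R t) \<longlongrightarrow> D v) (at 0)"
      by (simp add: tendsto_norm_zero_iff LIM_zero_iff)
    have "eventually (\<lambda>t. c t \<in> U) (at 0)"
    proof -
      have "isCont c 0" using c has_vector_derivative_continuous by blast
      then show ?thesis using UW(1) \<delta>(3) x(2) by (metis isContD topological_tendstoD)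
    qed
    moreover have "eventually (\<lambda>t. t \<in> {-\<delta><..<\<delta>}) (at 0)"
      using \<delta>(1) by (intro eventually_at_in_open') auto
    ultimately have "eventually (\<lambda>t. (\<phi> (c t) - \<phi> (c 0)) /\<^sub>R t \<in> E0) (at 0)"
    proof eventually_elim
      case (elim t)
      then have "c t \<in> S \<inter> U" "c 0 \<in> S \<inter> U" using \<delta> x by auto
      then have "\<phi> (c t) \<in> E0" "\<phi> (c 0) \<in> E0" using E0(3) openin_imp_subset by blast+
      then show ?case using E0(1) by (simp add: subspace_diff subspace_scale)
    qed
    then show "D v \<in> E0" by (rule Lim_in_closed_set[OF E0(2) _ _ lim]) simp
  next
    fix v assume "v \<in> {v. D v \<in> E0}"
    then have v: "D v \<in> E0" by simp
    obtain Z where Z: "open Z" "\<phi> ` (S \<inter> U) = E0 \<inter> Z" using E0(3) by (auto simp: openin_open)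
    define l where "l t = \<phi> x + t *\<^sub>R D v" for t
    have zx: "\<phi> x \<in> E0 \<inter> Z" using Z x by blast
    have "continuous_on UNIV l" unfolding l_def by (intro continuous_intros)
    then have "open (l -` (W \<inter> Z))" using UW Z by (intro open_vimage) auto
    moreover have "0 \<in> l -` (W \<inter> Z)" using W zx by (simp add: l_def)
    ultimately obtain \<delta> where \<delta>: "\<delta> > 0" "ball 0 \<delta> \<subseteq> l -` (W \<inter> Z)" using open_contains_ball by blast
    have l: "l t \<in> W" "l t \<in> \<phi> ` (S \<inter> U)" if "t \<in> {-\<delta><..<\<delta>}" for t
    proof -
      have "l t \<in> W \<inter> Z" using that \<delta> by (auto simp: subset_iff)
      moreover have "l t \<in> E0" unfolding l_def using E0(1) v zx by (simp add: subspace_add subspace_scale)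
      ultimately show "l t \<in> W" "l t \<in> \<phi> ` (S \<inter> U)" using Z by auto
    qed
    have l': "(l has_vector_derivative D v) (at t)" for t
      unfolding l_def by (auto intro!: derivative_eq_intros)
    have c': "((\<lambda>t. g (l t)) has_vector_derivative g' (l t) (D v)) (at t)" if "t \<in> {-\<delta><..<\<delta>}" for t
      using vector_derivative_diff_chain_within[OF l'[of t], of g "g' (l t)"] g[OF l(1)[OF that]]
        has_derivative_at_withinI by (auto simp: o_def)
    show "v \<in> tangent_space S x"
      unfolding tangent_space_def
    proof (intro CollectI exI conjI)
      show "\<delta> > 0" by fact
      have cl: "continuous_on {-\<delta><..<\<delta>} l"
        using \<open>continuous_on UNIV l\<close> by (rule continuous_on_subset) simp
      have "continuous_on {-\<delta><..<\<delta>} (\<lambda>t. g' (l t))"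
        by (rule continuous_on_compose2[OF g' cl]) (use l(1) in blast)
      then have "continuous_on {-\<delta><..<\<delta>} (\<lambda>t. g' (l t) (D v))"
        by (rule blinfun.continuous_on[OF _ continuous_on_const])
      then show "(\<lambda>t. g (l t)) C1_differentiable_on {-\<delta><..<\<delta>}"
        unfolding C1_differentiable_on_def
        by (intro exI[of _ "\<lambda>t. g' (l t) (D v)"] conjI ballI c')
      show "(\<lambda>t. g (l t)) ` {-\<delta><..<\<delta>} \<subseteq> S" using l(2) g\<phi> by fastforce
      show "g (l 0) = x" using g\<phi> x by (simp add: l_def)
      have "l 0 = \<phi> x" by (simp add: l_def)
      then show "((\<lambda>t. g (l t)) has_vector_derivative v) (at 0)" using c'[of 0] \<delta>(1) inv(1) by simp
    qed
  qed
qed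

text \<open>
  The derivative of a chart is a linear homeomorphism that carries the tangent space to the splitting
  model space, and it pulls the complement back as well.
\<close>

lemma tangent_space_splitting:
  assumes "C1_submanifold S" "x \<in> S"
  shows "splitting (tangent_space S x)"
proof -
  obtain E0 U \<phi> where E0: "splitting E0" and x: "x \<in> U" and diffeo: "C1_diffeo U (\<phi> ` U) \<phi>"
    and op: "openin (top_of_set E0) (\<phi> ` (S \<inter> U))"
    using assms unfolding C1_submanifold_def by meson
  obtain N0 where N0: "direct_sum E0 N0" using E0 by (auto simp: splitting_def)
  then have E0': "subspace E0" "closed E0" by (auto simp: direct_sum_def)
  obtain g \<phi>' g' where UW: "open U" "open (\<phi> ` U)" and hom: "homeomorphism U (\<phi> ` U) \<phi> g"
    and \<phi>: "\<And>u. u \<in> U \<Longrightarrow> (\<phi> has_derivative blinfun_apply (\<phi>' u)) (at u)"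
    and g: "\<And>w. w \<in> \<phi> ` U \<Longrightarrow> (g has_derivative blinfun_apply (g' w)) (at w)"
    using diffeo unfolding C1_diffeo_def C1_on_def by blast
  note inv = homeomorphism_derivatives_inverse[OF hom UW x \<phi>[OF x] g[OF imageI[OF x]]]
  have "bij (\<phi>' x)" using inv by (intro o_bij[where g = "g' (\<phi> x)"]) auto
  then have "direct_sum (\<phi>' x -` E0) (\<phi>' x -` N0)"
    by (rule direct_sum_vimage[OF N0 blinfun.bounded_linear_right])
  moreover have "tangent_space S x = \<phi>' x -` E0"
    using tangent_space_in_chart[OF diffeo assms(2) x E0' op \<phi>[OF x]] by auto
  ultimately show ?thesis by (auto simp: splitting_def)
qed

section \<open>Relative derivatives and graph operators\<close>

lemma abs_op_norm_on_le:
  assumes "0 \<in> F" "\<And>e. e \<in> F \<Longrightarrow> norm (A e) \<le> b * norm e" "0 \<le> b"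
  shows "\<bar>op_norm_on F A\<bar> \<le> b"
proof -
  have le: "norm (A e) \<le> b" if "e \<in> {e \<in> F. norm e \<le> 1}" for e
    using assms(2)[of e] assms(3) that mult_left_le[of "norm e" b] by simp
  have "op_norm_on F A \<le> b"
    unfolding op_norm_on_def by (rule cSUP_least) (use assms(1) le in auto)
  moreover have "norm (A 0) \<le> op_norm_on F A"
    unfolding op_norm_on_def
    by (rule cSUP_upper) (use assms(1) le in \<open>auto intro!: bdd_aboveI2\<close>)
  then have "0 \<le> op_norm_on F A" using norm_ge_zero order_trans by blast
  ultimately show ?thesis by simp
qed

text \<open>
  The bound \<open>K\<close> guarantees that the supremum defining the operator norm is taken over a bounded set.
\<close>

lemma norm_le_op_norm_on:
  assumes bd: "\<And>e. e \<in> F \<Longrightarrow> norm (A e) \<le> K * norm e" and sub: "subspace F"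
    and hom: "\<And>r e. e \<in> F \<Longrightarrow> A (r *\<^sub>R e) = r *\<^sub>R A e" and e: "e \<in> F"
  shows "norm (A e) \<le> op_norm_on F A * norm e"
proof (cases "e = 0")
  case True
  then show ?thesis using hom[OF e, of 0] by simp
next
  case False
  let ?u = "(1 / norm e) *\<^sub>R e"
  have "bdd_above ((\<lambda>e. norm (A e)) ` {e \<in> F. norm e \<le> 1})"
  proof (rule bdd_aboveI2)
    fix e assume "e \<in> {e \<in> F. norm e \<le> 1}"
    then have "norm (A e) \<le> K * norm e" "norm e \<le> 1" using bd by auto
    moreover have "K * norm e \<le> \<bar>K\<bar> * norm e" by (simp add: mult_right_mono)
    ultimately show "norm (A e) \<le> \<bar>K\<bar>" using mult_left_le[of "norm e" "\<bar>K\<bar>"] by linarith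
  qed
  moreover have "?u \<in> {e \<in> F. norm e \<le> 1}" using False sub e by (simp add: subspace_scale)
  ultimately have "norm (A ?u) \<le> op_norm_on F A" unfolding op_norm_on_def by (rule cSUP_upper[rotated])
  then show ?thesis using False hom[OF e] by (simp add: field_simps)
qed

text \<open>
  This trades derivatives relative to a subspace for ordinary ones: precomposing with the projection
  extends the map to an open part of the whole space, where the calculus of Frechet derivatives is
  available.
\<close>

lemma has_derivative_rel_compose_proj:
  assumes ds: "direct_sum F N" and rel: "has_derivative_rel F G f D (proj F N y)"
  shows "((\<lambda>z. f (proj F N z)) has_derivative (\<lambda>h. D (proj F N h))) (at y)"
proof -
  let ?P = "proj F N"
  interpret P: bounded_linear ?P by (rule bounded_linear_proj[OF ds])
  have PF: "?P z \<in> F" for z using proj_works[OF ds] by blast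
  obtain K where K: "K > 0" "\<And>z. norm (?P z) \<le> norm z * K" using P.pos_bounded by blast
  have D: "D \<in> bounded_ops F G"
    and lim: "((\<lambda>h. norm (f (?P y + h) - f (?P y) - D h) / norm h) \<longlongrightarrow> 0) (at 0 within F)"
    using rel by (auto simp: has_derivative_rel_def)
  then obtain C where C: "\<And>e. e \<in> F \<Longrightarrow> norm (D e) \<le> C * norm e"
    unfolding bounded_ops_def by blast
  have D0: "D 0 = 0"
    using D PF[of 0] unfolding bounded_ops_def P.zero by (force dest!: spec[of _ 0])
  have bl: "bounded_linear (\<lambda>h. D (?P h))"
  proof (rule bounded_linear_intro[where K = "\<bar>C\<bar> * K"])
    fix a b and r :: real
    show "D (?P (a + b)) = D (?P a) + D (?P b)" "D (?P (r *\<^sub>R a)) = r *\<^sub>R D (?P a)"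
      using D PF by (simp_all add: bounded_ops_def P.add P.scale)
    have "norm (D (?P a)) \<le> C * norm (?P a)" using C PF by blast
    also have "\<dots> \<le> \<bar>C\<bar> * (norm a * K)" using K(2)[of a] by (intro mult_mono) auto
    finally show "norm (D (?P a)) \<le> norm a * (\<bar>C\<bar> * K)" by (simp add: mult_ac)
  qed
  show ?thesis
    unfolding has_derivative_at_alt
  proof (intro conjI allI impI bl)
    fix \<epsilon> :: real assume "\<epsilon> > 0"
    then have "\<epsilon> / K > 0" using K(1) by simp
    with lim obtain \<delta> where \<delta>: "\<delta> > 0" "\<forall>h\<in>F. 0 < dist h 0 \<and> dist h 0 < \<delta> \<longrightarrow>
        dist (norm (f (?P y + h) - f (?P y) - D h) / norm h) 0 < \<epsilon> / K"
      unfolding Lim_within by meson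
    have small: "norm (f (?P y + h) - f (?P y) - D h) \<le> \<epsilon> / K * norm h" if "h \<in> F" "norm h < \<delta>" for h
    proof (cases "h = 0")
      case False
      then have "norm (f (?P y + h) - f (?P y) - D h) / norm h < \<epsilon> / K" using \<delta>(2) that by simp
      then have "norm (f (?P y + h) - f (?P y) - D h) < \<epsilon> / K * norm h"
        using False by (subst (asm) pos_divide_less_eq) simp_all
      then show ?thesis by simp
    qed (simp add: D0)
    show "\<exists>d>0. \<forall>z. norm (z - y) < d \<longrightarrow>
        norm (f (?P z) - f (?P y) - D (?P (z - y))) \<le> \<epsilon> * norm (z - y)"
    proof (intro exI[of _ "\<delta> / K"] conjI allI impI)
      show "\<delta> / K > 0" using \<delta> K by simp
      fix z assume "norm (z - y) < \<delta> / K"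
      then have "norm (?P (z - y)) < \<delta>" using K(2)[of "z - y"] K(1) by (simp add: field_simps)
      from small[OF PF this] have "norm (f (?P z) - f (?P y) - D (?P (z - y))) \<le> \<epsilon> / K * norm (?P (z - y))"
        by (simp add: P.diff)
      also have "\<dots> \<le> \<epsilon> / K * (norm (z - y) * K)" using K \<open>\<epsilon> > 0\<close> by (intro mult_left_mono) auto
      finally show "norm (f (?P z) - f (?P y) - D (?P (z - y))) \<le> \<epsilon> * norm (z - y)" using K(1) by simp
    qed
  qed
qed

lemma has_derivative_imp_rel:
  assumes f: "(f has_derivative D) (at x)" and F: "subspace F" and D: "\<And>e. e \<in> F \<Longrightarrow> D e \<in> G"
  shows "has_derivative_rel F G f (restrict D F) x"
proof -
  interpret bounded_linear D using f by (rule has_derivative_bounded_linear)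
  have "\<exists>K. \<forall>e\<in>F. norm (D e) \<le> K * norm e" using bounded by (metis mult.commute)
  then have "restrict D F \<in> bounded_ops F G"
    using F D by (auto simp: bounded_ops_def add scale subspace_add subspace_scale)
  moreover have "((\<lambda>h. norm (f (x + h) - f x - D h) / norm h) \<longlongrightarrow> 0) (at 0 within F)"
    using f has_derivative_at tendsto_within_subset by blast
  then have "((\<lambda>h. norm (f (x + h) - f x - restrict D F h) / norm h) \<longlongrightarrow> 0) (at 0 within F)"
    by (rule Lim_transform_eventually) (simp add: eventually_at_filter)
  ultimately show ?thesis by (simp add: has_derivative_rel_def)
qed

lemma alpha_eqI:
  assumes "direct_sum (M x0) N" "A \<in> bounded_ops (M x0) N" "M x = {e + A e |e. e \<in> M x0}"
  shows "alpha M x0 N x = A"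
  unfolding alpha_def
proof (rule the_equality)
  fix B assume "B \<in> bounded_ops (M x0) N \<and> M x = {e + B e |e. e \<in> M x0}"
  then show "B = A" using alpha_unique[of M x0 N B x A] assms by blast
qed (use assms in blast)

text \<open>
  The definite description in \<open>alpha\<close> needs a witness: the operator sends \<open>e\<close> to
  \<open>proj (M x) N e - e\<close>, and it is bounded because projections are.
\<close>

lemma alpha_graph:
  assumes ds0: "direct_sum (M x0) N" and ds: "direct_sum (M x) N"
  shows "M x = {e + alpha M x0 N x e |e. e \<in> M x0}"
proof -
  let ?Q = "proj (M x) N"
  define A where "A = restrict (\<lambda>e. ?Q e - e) (M x0)"
  interpret Q: bounded_linear ?Q by (rule bounded_linear_proj[OF ds])
  have sub: "subspace (M x0)" "subspace N" using ds0 by (auto simp: direct_sum_def)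
  have N: "?Q e - e \<in> N" for e
    using subspace_neg[OF sub(2), of "e - ?Q e"] proj_works[OF ds, of e] by simp
  have "bounded_linear (\<lambda>e. ?Q e - e)"
    by (intro bounded_linear_sub Q.bounded_linear_axioms bounded_linear_ident)
  then obtain K where "\<And>e. norm (?Q e - e) \<le> norm e * K" using bounded_linear.bounded by blast
  then have "\<exists>K. \<forall>e\<in>M x0. norm (?Q e - e) \<le> K * norm e" by (metis mult.commute)
  then have A: "A \<in> bounded_ops (M x0) N"
    using sub N by (auto simp: A_def bounded_ops_def Q.add Q.scale subspace_add subspace_scale algebra_simps)
  have graph: "M x = {e + A e |e. e \<in> M x0}"
  proof (intro equalityI subsetI)
    fix m assume m: "m \<in> M x"
    let ?e = "proj (M x0) N m"
    have e: "?e \<in> M x0" "m - ?e \<in> N" using proj_works[OF ds0] by auto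
    then have "?e - m \<in> N" using subspace_neg[OF sub(2), of "m - ?e"] by simp
    then have "?Q ?e = m" using m by (intro direct_sum_unique_proj[OF ds])
    then have "m = ?e + A ?e" using e by (simp add: A_def)
    then show "m \<in> {e + A e |e. e \<in> M x0}" using e by blast
  next
    fix m assume "m \<in> {e + A e |e. e \<in> M x0}"
    then show "m \<in> M x" using proj_works[OF ds] by (auto simp: A_def)
  qed
  show ?thesis using alpha_eqI[OF ds0 A graph] graph by simp
qed

section \<open>From an integral manifold to a solution over the reference space\<close>

text \<open>
  The chart \<open>\<phi>\<close> is corrected so that its domain splits along \<open>M x0\<close> and \<open>N\<close> and its first component is
  the projection. With \<open>L\<close> the derivative of \<open>\<phi>\<close> at \<open>x0\<close>, put
  \<open>H y = P y + (id - P) (L\<^sup>-\<^sup>1 (\<phi> y))\<close>. Since \<open>L\<close> maps \<open>M x0\<close> onto the model space \<open>E0\<close>, \<open>H y\<close> lies in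
  \<open>M x0\<close> exactly when \<open>\<phi> y\<close> lies in \<open>E0\<close>, that is, for \<open>y\<close> near \<open>x0\<close>, when \<open>y\<close> lies in \<open>S\<close>; and the derivative of \<open>H\<close> at
  \<open>x0\<close> is \<open>P + (id - P) = id\<close>. Let \<open>K\<close> be the local inverse of \<open>H\<close>. As \<open>P (H y) = P y\<close>, the point \<open>K v\<close>
  for \<open>v\<close> in \<open>M x0\<close> lies over \<open>v\<close>, so \<open>\<psi> v = K v - v\<close> has values in \<open>N\<close> and its graph lies in \<open>S\<close>.
  The derivative of \<open>H\<close> at \<open>y = K v\<close> pulls \<open>M x0\<close> back to the tangent space \<open>M y\<close> and \<open>N\<close> back to
  \<open>N\<close>; hence \<open>M y\<close> and \<open>N\<close> are complementary, and \<open>M y\<close> is the graph of the derivative of \<open>\<psi>\<close>.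
\<close>

lemma integrable_imp_graph:
  assumes S: "C1_submanifold S" "x0 \<in> S" "S \<subseteq> \<Lambda>" and TS: "\<And>x. x \<in> S \<Longrightarrow> tangent_space S x = M x"
    and ds: "direct_sum (M x0) N"
  shows "\<exists>V \<psi>. openin (top_of_set (M x0)) V \<and> proj (M x0) N x0 \<in> V \<and>
              \<psi> \<in> C1_maps (M x0) V N \<and>
              {x + \<psi> x | x. x \<in> V} \<subseteq> cotailed M \<Lambda> N \<and>
              (\<forall>x\<in>V. has_derivative_rel (M x0) N \<psi> (alpha M x0 N (x + \<psi> x)) x) \<and>
              \<psi> (proj (M x0) N x0) = proj N (M x0) x0"
proof -
  obtain E0 U \<phi> where "splitting E0" and x0: "x0 \<in> U" and diffeo: "C1_diffeo U (\<phi> ` U) \<phi>"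
    and op: "openin (top_of_set E0) (\<phi> ` (S \<inter> U))"
    using S unfolding C1_submanifold_def by meson
  then have E0: "subspace E0" "closed E0" by (auto simp: splitting_def direct_sum_def)
  obtain g \<phi>' g' where UW: "open U" "open (\<phi> ` U)" and hom: "homeomorphism U (\<phi> ` U) \<phi> g"
    and \<phi>: "\<And>u. u \<in> U \<Longrightarrow> (\<phi> has_derivative blinfun_apply (\<phi>' u)) (at u)" and cont\<phi>': "continuous_on U \<phi>'"
    and g: "\<And>w. w \<in> \<phi> ` U \<Longrightarrow> (g has_derivative blinfun_apply (g' w)) (at w)"
    using diffeo unfolding C1_diffeo_def C1_on_def by blast
  note inv = homeomorphism_derivatives_inverse[OF hom UW x0 \<phi>[OF x0] g[OF imageI[OF x0]]]
  have M_chart: "M y = {h. \<phi>' y h \<in> E0}" if "y \<in> S" "y \<in> U" for y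
    using tangent_space_in_chart[OF diffeo that E0 op \<phi>[OF that(2)]] TS[OF that(1)] by simp
  define F where "F = M x0"
  note ds = ds[folded F_def]
  have sub: "subspace F" "subspace N" and FN: "F \<inter> N = {0}" using ds by (auto simp: direct_sum_def)
  define P where "P = Blinfun (proj F N)"
  have P: "blinfun_apply P = proj F N"
    unfolding P_def by (rule bounded_linear_Blinfun_apply[OF bounded_linear_proj[OF ds]])
  have PF: "P h \<in> F" and PN: "h - P h \<in> N" for h using proj_works[OF ds] by (auto simp: P)
  have P_F: "P h = h" if "h \<in> F" for h using proj_on_range[OF ds that] by (simp add: P)
  have P_N: "P h = 0 \<longleftrightarrow> h \<in> N" for h using proj_on_kernel[OF ds] PN[of h] by (auto simp: P)
  \<comment> \<open>the inverse of the derivative of \<open>\<phi>\<close> at \<open>x0\<close>\<close>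
  define R where "R = g' (\<phi> x0)"
  have R_F: "R u \<in> F \<longleftrightarrow> u \<in> E0" for u
    using M_chart[OF S(2) x0] inv(2) by (simp add: F_def R_def)
  define Q where "Q = id_blinfun - P"
  have Q: "Q h = h - P h" for h by (simp add: Q_def blinfun.diff_left)
  have Q_N: "Q h \<in> N" for h using PN by (simp add: Q)
  have Q_0: "Q h = 0 \<longleftrightarrow> h \<in> F" for h using P_F PF[of h] by (metis Q eq_iff_diff_eq_0)
  \<comment> \<open>\<open>H\<close> and its derivatives all have the form \<open>P a + Q b\<close>; the next three facts read off their
    components along \<open>F\<close> and \<open>N\<close>\<close>
  have sum_F: "P a + Q b \<in> F \<longleftrightarrow> b \<in> F" for a b
  proof -
    have "P a + Q b \<in> F \<longleftrightarrow> Q b \<in> F"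
      using sub PF[of a] by (metis add_diff_cancel_left' subspace_add subspace_diff)
    also have "\<dots> \<longleftrightarrow> Q b = 0" using Q_N[of b] FN subspace_0[OF sub(1)] by auto
    finally show ?thesis by (simp add: Q_0)
  qed
  have sum_N: "P a + Q b \<in> N \<longleftrightarrow> a \<in> N" for a b
  proof -
    have "P a + Q b \<in> N \<longleftrightarrow> P a \<in> N"
      using sub Q_N[of b] by (metis add_diff_cancel_right' subspace_add subspace_diff)
    also have "\<dots> \<longleftrightarrow> P a = 0" using PF[of a] FN subspace_0[OF sub(2)] by auto
    finally show ?thesis by (simp add: P_N)
  qed
  have sum_P: "P (P a + Q b) = P a" for a b
    using P_N[of "Q b"] Q_N P_F[OF PF] by (simp add: blinfun.add_right)
  define H where "H y = P y + Q (R (\<phi> y))" for y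
  define H' where "H' y = P + (Q o\<^sub>L (R o\<^sub>L \<phi>' y))" for y
  have H': "H' y h = P h + Q (R (\<phi>' y h))" for y h by (simp add: H'_def blinfun.add_left)
  obtain Z where Z: "open Z" "\<phi> ` (S \<inter> U) = E0 \<inter> Z" using op by (auto simp: openin_open)
  \<comment> \<open>inside \<open>U\<close> the condition \<open>\<phi> y \<in> E0\<close> alone does not force \<open>y \<in> S\<close>, because the chart image
    of \<open>S\<close> is only relatively open in \<open>E0\<close>; shrinking the domain repairs this\<close>
  define U1 where "U1 = U \<inter> \<phi> -` Z"
  have "open U1" unfolding U1_def
    using hom UW(1) Z(1) by (intro continuous_open_preimage) (auto simp: homeomorphism_def)
  have "\<phi> x0 \<in> E0 \<inter> Z" using Z(2) S(2) x0 by blast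
  then have "x0 \<in> U1" and \<phi>x0: "\<phi> x0 \<in> E0" using x0 by (auto simp: U1_def)
  have in_S: "y \<in> S" if "y \<in> U1" "\<phi> y \<in> E0" for y
  proof -
    have "\<phi> y \<in> \<phi> ` (S \<inter> U)" using that Z(2) by (auto simp: U1_def)
    then obtain s where "s \<in> S" "s \<in> U" "\<phi> y = \<phi> s" by blast
    moreover have "y \<in> U" using that by (auto simp: U1_def)
    ultimately show ?thesis using hom unfolding homeomorphism_def by metis
  qed
  have Hx0: "H x0 = P x0" using \<phi>x0 R_F Q_0 by (simp add: H_def)
  have dH: "(H has_derivative blinfun_apply (H' y)) (at y)" if "y \<in> U1" for y
  proof -
    have y: "y \<in> U" using that by (simp add: U1_def)
    have "((\<lambda>y. P y) has_derivative (\<lambda>h. P h)) (at y)"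
      by (intro bounded_linear_imp_has_derivative blinfun.bounded_linear_right)
    moreover have "((\<lambda>y. Q (R (\<phi> y))) has_derivative (\<lambda>h. Q (R (\<phi>' y h)))) (at y)"
      by (intro bounded_linear.has_derivative[OF blinfun.bounded_linear_right[of Q]]
          bounded_linear.has_derivative[OF blinfun.bounded_linear_right[of R]] \<phi>[OF y])
    ultimately have "((\<lambda>y. P y + Q (R (\<phi> y))) has_derivative (\<lambda>h. P h + Q (R (\<phi>' y h)))) (at y)"
      by (rule has_derivative_add)
    moreover have "blinfun_apply (H' y) = (\<lambda>h. P h + Q (R (\<phi>' y h)))" by (simp add: H' fun_eq_iff)
    ultimately show ?thesis by (simp only: H_def[abs_def])
  qed
  have cH: "continuous_on U1 H'"
  proof -
    have "continuous_on U1 \<phi>'" using cont\<phi>' by (rule continuous_on_subset) (simp add: U1_def)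
    then show ?thesis unfolding H'_def
      by (intro continuous_intros bounded_linear.continuous_on[OF
            bounded_bilinear.bounded_linear_right[OF bounded_bilinear_blinfun_compose]])
  qed
  have "H' x0 = id_blinfun"
    by (rule blinfun_eqI) (simp add: H' inv R_def Q)
  then obtain T K K' where T: "open T" "H x0 \<in> T" "K (H x0) = x0"
    and K: "\<And>z. z \<in> T \<Longrightarrow> K z \<in> U1" "\<And>z. z \<in> T \<Longrightarrow> H (K z) = z"
      "\<And>z. z \<in> T \<Longrightarrow> bij (H' (K z))"
      "\<And>z. z \<in> T \<Longrightarrow> (K has_derivative blinfun_apply (K' z)) (at z)"
      "\<And>z h. z \<in> T \<Longrightarrow> H' (K z) (K' z h) = h"
    and cK': "continuous_on T (K' :: 'a \<Rightarrow> 'a \<Rightarrow>\<^sub>L 'a)"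
    using inverse_function_theorem_at_identity[OF \<open>open U1\<close> \<open>x0 \<in> U1\<close> dH cH, of thesis] by blast
  define V where "V = F \<inter> T"
  define \<psi> where "\<psi> v = K v - v" for v
  define D where "D v = restrict (\<lambda>e. K' v e - e) F" for v
  have V: "P (K v) = v" "K v \<in> S \<inter> U" if v: "v \<in> V" for v
  proof -
    have T: "v \<in> T" and F: "v \<in> F" using v by (auto simp: V_def)
    then show "P (K v) = v" using sum_P[of "K v" "R (\<phi> (K v))"] K(2)[OF T] P_F by (simp add: H_def)
    have "\<phi> (K v) \<in> E0" using sum_F K(2)[OF T] F R_F unfolding H_def by metis
    then show "K v \<in> S \<inter> U" using in_S K(1)[OF T] by (auto simp: U1_def)
  qed
  have M_K: "M (K v) = H' (K v) -` F" if "v \<in> V" for v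
    using M_chart[of "K v"] V(2)[OF that] by (auto simp: H' sum_F R_F)
  have ds_K: "direct_sum (M (K v)) N" if v: "v \<in> V" for v
  proof -
    have "direct_sum (H' (K v) -` F) (H' (K v) -` N)"
      using v K(3) by (intro direct_sum_vimage ds blinfun.bounded_linear_right) (auto simp: V_def)
    moreover have "H' (K v) -` N = N" by (auto simp: H' sum_N)
    ultimately show ?thesis by (simp add: M_K[OF v])
  qed
  have K'_N: "K' v e - e \<in> N" if v: "v \<in> V" and e: "e \<in> F" for v e
  proof -
    have "H' (K v) (K' v e) = e" using K(5) v by (simp add: V_def)
    then have "P (K' v e) = e" using sum_P P_F[OF e] unfolding H' by metis
    then show ?thesis using PN[of "K' v e"] by simp
  qed
  have rel: "has_derivative_rel F N \<psi> (D v) v" if v: "v \<in> V" for v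
    unfolding D_def
  proof (rule has_derivative_imp_rel[OF _ sub(1)])
    show "(\<psi> has_derivative (\<lambda>e. K' v e - e)) (at v)"
      unfolding \<psi>_def using K(4) v by (auto intro!: derivative_eq_intros simp: V_def)
  qed (rule K'_N[OF v])
  have alpha: "alpha M x0 N (K v) = D v" if v: "v \<in> V" for v
  proof (rule alpha_eqI)
    have "v \<in> T" using v by (simp add: V_def)
    show "direct_sum (M x0) N" using ds by (simp add: F_def)
    show "D v \<in> bounded_ops (M x0) N" using rel[OF v] by (simp add: has_derivative_rel_def F_def)
    have "h = K' v (H' (K v) h)" for h
      using K(5)[OF \<open>v \<in> T\<close>, of "H' (K v) h"] K(3)[OF \<open>v \<in> T\<close>] by (metis bij_is_inj injD)
    then show "M (K v) = {e + D v e |e. e \<in> M x0}"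
      using K(5)[OF \<open>v \<in> T\<close>] unfolding M_K[OF v] F_def[symmetric] D_def by force
  qed
  have "\<psi> \<in> C1_maps F V N"
    unfolding C1_maps_def
  proof (intro CollectI conjI exI[of _ D] ballI)
    have "\<psi> v \<in> N" if "v \<in> V" for v using PN[of "K v"] V(1)[OF that] by (simp add: \<psi>_def)
    then show "\<psi> ` V \<subseteq> N" by blast
    fix v assume v: "v \<in> V"
    show "has_derivative_rel F N \<psi> (D v) v" by (rule rel[OF v])
    have "continuous_on V K'" using cK' by (rule continuous_on_subset) (simp add: V_def)
    then have "(K' \<longlongrightarrow> K' v) (at v within V)" using v by (simp add: continuous_on_def)
    then have lim: "((\<lambda>w. norm (K' w - K' v)) \<longlongrightarrow> 0) (at v within V)"
      by (intro tendsto_norm_zero LIM_zero)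
    have le: "norm (op_norm_on F (\<lambda>e. D w e - D v e)) \<le> norm (K' w - K' v)" for w
    proof -
      have le: "norm (D w e - D v e) \<le> norm (K' w - K' v) * norm e" if "e \<in> F" for e
        using norm_blinfun[of "K' w - K' v" e] that by (simp add: D_def blinfun.diff_left)
      have "\<bar>op_norm_on F (\<lambda>e. D w e - D v e)\<bar> \<le> norm (K' w - K' v)"
        by (rule abs_op_norm_on_le) (use subspace_0[OF sub(1)] le in auto)
      then show ?thesis by simp
    qed
    show "((\<lambda>w. op_norm_on F (\<lambda>e. D w e - D v e)) \<longlongrightarrow> 0) (at v within V)"
      by (rule Lim_null_comparison[OF _ lim]) (simp only: le eventually_True)
  qed
  moreover have "openin (top_of_set F) V" using T(1) by (auto simp: V_def openin_open)
  moreover have "proj F N x0 \<in> V" using T(2) Hx0 PF[of x0] by (simp add: V_def P)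
  moreover have "\<psi> (proj F N x0) = proj N F x0"
    using T(3) Hx0 proj_complement[OF ds] by (simp add: \<psi>_def P)
  moreover have "{x + \<psi> x | x. x \<in> V} \<subseteq> cotailed M \<Lambda> N"
    using ds_K V(2) S(3) by (auto simp: cotailed_def \<psi>_def)
  moreover have "\<forall>x\<in>V. has_derivative_rel F N \<psi> (alpha M x0 N (x + \<psi> x)) x"
    using rel alpha by (simp add: \<psi>_def)
  ultimately show ?thesis unfolding F_def by blast
qed

section \<open>From a solution to an integral manifold\<close>

text \<open>
  Subtracting \<open>\<psi> \<circ> P\<close> shears the graph of \<open>\<psi>\<close> flat onto \<open>V\<close>. The shear moves points along \<open>N\<close> and
  therefore keeps \<open>P\<close> fixed, so its inverse is the opposite shear.
\<close>

lemma graph_chart: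
  assumes ds: "direct_sum F N" and V: "openin (top_of_set F) V" and \<psi>: "\<psi> \<in> C1_maps F V N"
  shows "C1_diffeo (proj F N -` V) (proj F N -` V) (\<lambda>y. y - \<psi> (proj F N y))"
proof -
  let ?P = "proj F N"
  let ?U = "?P -` V"
  interpret P: bounded_linear ?P by (rule bounded_linear_proj[OF ds])
  have PF: "?P h \<in> F" for h using proj_works[OF ds] by blast
  have subF: "subspace F" using ds by (auto simp: direct_sum_def)
  obtain Z where Z: "open Z" "V = F \<inter> Z" using V by (auto simp: openin_open)
  have "?U = ?P -` Z" using PF Z by auto
  then have "open ?U"
    using open_vimage[OF Z(1) linear_continuous_on[OF P.bounded_linear_axioms]] by simp
  obtain D where D: "\<And>v. v \<in> V \<Longrightarrow> has_derivative_rel F N \<psi> (D v) v"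
    and cD: "\<And>v. v \<in> V \<Longrightarrow> ((\<lambda>w. op_norm_on F (\<lambda>e. D w e - D v e)) \<longlongrightarrow> 0) (at v within V)"
    and \<psi>N: "\<psi> ` V \<subseteq> N"
    using \<psi> unfolding C1_maps_def by blast
  define B where "B y = Blinfun (\<lambda>h. D (?P y) (?P h))" for y
  have d: "((\<lambda>z. \<psi> (?P z)) has_derivative (\<lambda>h. D (?P y) (?P h))) (at y)" if "y \<in> ?U" for y
    using that by (intro has_derivative_rel_compose_proj[OF ds, where G = N] D) simp
  have B: "blinfun_apply (B y) = (\<lambda>h. D (?P y) (?P h))" if "y \<in> ?U" for y
    unfolding B_def using has_derivative_bounded_linear[OF d[OF that]] by (rule bounded_linear_Blinfun_apply)
  obtain K where K: "K > 0" "\<And>z. norm (?P z) \<le> norm z * K" using P.pos_bounded by blast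
  have B_lip: "norm (B z - B y) \<le> \<bar>op_norm_on F (\<lambda>e. D (?P z) e - D (?P y) e)\<bar> * K"
    if y: "y \<in> ?U" and z: "z \<in> ?U" for y z
  proof (rule norm_blinfun_bound)
    fix h
    have app: "(B z - B y) h = D (?P z) (?P h) - D (?P y) (?P h)" for h
      using B y z by (simp add: blinfun.diff_left)
    \<comment> \<open>elements of \<open>F\<close> are their own projections, so the norm of \<open>B z - B y\<close> supplies the bound
      that the operator norm on \<open>F\<close> needs to be meaningful\<close>
    have restr: "D (?P z) e - D (?P y) e = (B z - B y) e" if "e \<in> F" for e
      using app[of e] proj_on_range[OF ds that] by simp
    have "norm (D (?P z) (?P h) - D (?P y) (?P h)) \<le>
        op_norm_on F (\<lambda>e. D (?P z) e - D (?P y) e) * norm (?P h)"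
    proof (rule norm_le_op_norm_on[OF _ subF _ PF])
      fix e r assume "e \<in> F"
      then show "norm (D (?P z) e - D (?P y) e) \<le> norm (B z - B y) * norm e"
        "D (?P z) (r *\<^sub>R e) - D (?P y) (r *\<^sub>R e) = r *\<^sub>R (D (?P z) e - D (?P y) e)"
        using subF by (simp_all add: restr norm_blinfun subspace_scale blinfun.scaleR_right)
    qed
    also have "\<dots> \<le> \<bar>op_norm_on F (\<lambda>e. D (?P z) e - D (?P y) e)\<bar> * (norm h * K)"
      using K by (intro mult_mono) auto
    finally show "norm ((B z - B y) h) \<le> \<bar>op_norm_on F (\<lambda>e. D (?P z) e - D (?P y) e)\<bar> * K * norm h"
      by (simp add: app mult_ac)
  qed (use K in simp)
  have cB: "continuous_on ?U B"
    unfolding continuous_on_iff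
  proof (intro ballI allI impI)
    fix y and \<epsilon> :: real assume y: "y \<in> ?U" and "\<epsilon> > 0"
    then have "\<epsilon> / K > 0" using K(1) by simp
    moreover have "((\<lambda>w. op_norm_on F (\<lambda>e. D w e - D (?P y) e)) \<longlongrightarrow> 0) (at (?P y) within V)"
      using cD y by simp
    ultimately obtain \<delta> where \<delta>: "\<delta> > 0" "\<forall>w\<in>V. 0 < dist w (?P y) \<and> dist w (?P y) < \<delta> \<longrightarrow>
        dist (op_norm_on F (\<lambda>e. D w e - D (?P y) e)) 0 < \<epsilon> / K"
      unfolding Lim_within by meson
    show "\<exists>\<delta>>0. \<forall>z\<in>?U. dist z y < \<delta> \<longrightarrow> dist (B z) (B y) < \<epsilon>"
    proof (intro exI[of _ "\<delta> / K"] conjI ballI impI)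
      show "\<delta> / K > 0" using \<delta> K by simp
      fix z assume z: "z \<in> ?U" "dist z y < \<delta> / K"
      then have close: "dist (?P z) (?P y) < \<delta>"
        using K(2)[of "z - y"] K(1) by (simp add: dist_norm P.diff field_simps)
      show "dist (B z) (B y) < \<epsilon>"
      proof (cases "?P z = ?P y")
        case True
        then show ?thesis using \<open>\<epsilon> > 0\<close> by (simp add: B_def)
      next
        case False
        then have "\<bar>op_norm_on F (\<lambda>e. D (?P z) e - D (?P y) e)\<bar> < \<epsilon> / K"
          using \<delta>(2) z close by (simp add: dist_real_def)
        then have "\<bar>op_norm_on F (\<lambda>e. D (?P z) e - D (?P y) e)\<bar> * K < \<epsilon>"
          using K(1) by (simp only: pos_less_divide_eq)
        then show ?thesis using B_lip[OF y z(1)] by (simp add: dist_norm)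
      qed
    qed
  qed
  have P\<psi>: "?P (y - \<psi> (?P y)) = ?P y" "?P (y + \<psi> (?P y)) = ?P y" if "y \<in> ?U" for y
    using that \<psi>N proj_on_kernel[OF ds, of "\<psi> (?P y)"] by (auto simp: P.diff P.add)
  have C1: "C1_on ?U (\<lambda>y. y - \<psi> (?P y))" "C1_on ?U (\<lambda>y. y + \<psi> (?P y))"
    unfolding C1_on_def
  proof -
    show "\<exists>f'. (\<forall>y\<in>?U. ((\<lambda>y. y - \<psi> (?P y)) has_derivative blinfun_apply (f' y)) (at y)) \<and> continuous_on ?U f'"
      by (intro exI[of _ "\<lambda>y. id_blinfun - B y"] conjI ballI continuous_intros cB)
         (auto intro!: derivative_eq_intros d simp: blinfun.diff_left B)
    show "\<exists>f'. (\<forall>y\<in>?U. ((\<lambda>y. y + \<psi> (?P y)) has_derivative blinfun_apply (f' y)) (at y)) \<and> continuous_on ?U f'"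
      by (intro exI[of _ "\<lambda>y. id_blinfun + B y"] conjI ballI continuous_intros cB)
         (auto intro!: derivative_eq_intros d simp: blinfun.add_left B)
  qed
  have cont: "continuous_on ?U f" if "C1_on ?U f" for f
    using that unfolding C1_on_def
    by (blast intro: continuous_at_imp_continuous_on has_derivative_continuous)
  have "homeomorphism ?U ?U (\<lambda>y. y - \<psi> (?P y)) (\<lambda>y. y + \<psi> (?P y))"
    by (rule homeomorphismI) (use cont C1 P\<psi> in auto)
  then show ?thesis using \<open>open ?U\<close> C1 unfolding C1_diffeo_def by blast
qed

text \<open>
  The manifold is the graph of \<open>\<psi>\<close>, flattened by the shear above. In that chart a tangent vector \<open>h\<close>
  at \<open>v + \<psi> v\<close> is one with \<open>h - \<psi>' (P h)\<close> in \<open>M x0\<close>; comparing components, this says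
  \<open>h = P h + \<psi>' (P h)\<close>, so \<open>h\<close> ranges over the graph of the derivative. By the differential equation
  that graph is \<open>M (v + \<psi> v)\<close>.
\<close>

lemma graph_imp_integrable:
  assumes ds: "direct_sum (M x0) N" and V: "openin (top_of_set (M x0)) V" "proj (M x0) N x0 \<in> V"
    and \<psi>: "\<psi> \<in> C1_maps (M x0) V N"
    and cot: "{x + \<psi> x | x. x \<in> V} \<subseteq> cotailed M \<Lambda> N"
    and rel: "\<And>x. x \<in> V \<Longrightarrow> has_derivative_rel (M x0) N \<psi> (alpha M x0 N (x + \<psi> x)) x"
    and init: "\<psi> (proj (M x0) N x0) = proj N (M x0) x0"
  shows "C1_integrable_at M \<Lambda> x0"
proof -
  define F where "F = M x0"
  note ds = ds[folded F_def] and V = V[folded F_def] and \<psi> = \<psi>[folded F_def]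
    and rel = rel[folded F_def] and init = init[folded F_def]
  let ?P = "proj F N"
  let ?U = "?P -` V"
  let ?\<phi> = "\<lambda>y. y - \<psi> (?P y)"
  define S where "S = {x + \<psi> x | x. x \<in> V}"
  interpret P: bounded_linear ?P by (rule bounded_linear_proj[OF ds])
  have F: "subspace F" "closed F" and N: "subspace N" and FN: "F \<inter> N = {0}"
    using ds by (auto simp: direct_sum_def)
  have VF: "V \<subseteq> F" using V(1) openin_imp_subset by blast
  have PS: "?P (v + \<psi> v) = v" if "v \<in> V" for v
  proof -
    have "\<psi> v \<in> N" using \<psi> that by (auto simp: C1_maps_def)
    then show ?thesis using that VF proj_on_range[OF ds] proj_on_kernel[OF ds] by (simp add: P.add subset_iff)
  qed
  have SU: "S \<subseteq> ?U" using PS by (auto simp: S_def)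
  have chart: "?\<phi> ` (S \<inter> ?U) = V"
  proof -
    have "?\<phi> ` (S \<inter> ?U) = ?\<phi> ` S" using SU by (simp add: Int_absorb2)
    also have "\<dots> = (\<lambda>v. v) ` V"
      unfolding S_def Setcompr_eq_image image_image by (rule image_cong) (simp_all add: PS)
    finally show ?thesis by simp
  qed
  have diffeo: "C1_diffeo ?U ?U ?\<phi>" by (rule graph_chart[OF ds V(1) \<psi>])
  then have "?\<phi> ` ?U = ?U" unfolding C1_diffeo_def homeomorphism_def by blast
  then have "C1_submanifold S"
    unfolding C1_submanifold_def
    using ds diffeo V(1) chart SU
    by (intro ballI exI[of _ F] exI[of _ ?U] exI[of _ ?\<phi>]) (auto simp: splitting_def)
  moreover have "x0 \<in> S"
    using V(2) init proj_complement[OF ds] by (force simp: S_def)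
  moreover have "S \<subseteq> \<Lambda>" using cot by (auto simp: S_def cotailed_def)
  moreover have "tangent_space S y = M y" if y: "y \<in> S" for y
  proof -
    obtain v where v: "v \<in> V" "y = v + \<psi> v" using y by (auto simp: S_def)
    then have Py: "?P y = v" using PS by simp
    let ?A = "alpha M x0 N y"
    have A: "?A e \<in> N" if "e \<in> F" for e
      using rel[OF v(1)] that v(2) by (auto simp: has_derivative_rel_def bounded_ops_def)
    have "has_derivative_rel F N \<psi> ?A (?P y)" using rel[OF v(1)] v(2) Py by simp
    from has_derivative_rel_compose_proj[OF ds this]
    have "(?\<phi> has_derivative (\<lambda>h. h - ?A (?P h))) (at y)"
      by (auto intro!: derivative_eq_intros)
    from tangent_space_in_chart[OF diffeo y _ F _ this]
    have "tangent_space S y = {h. h - ?A (?P h) \<in> F}" using chart V(1) SU y by auto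
    also have "\<dots> = {e + ?A e |e. e \<in> F}"
    proof (intro equalityI subsetI)
      fix h assume "h \<in> {h. h - ?A (?P h) \<in> F}"
      then have "h - ?A (?P h) \<in> F" by simp
      then have "(h - ?A (?P h)) - ?P h \<in> F" using F(1) proj_works[OF ds] by (blast intro: subspace_diff)
      moreover have "(h - ?P h) - ?A (?P h) \<in> N"
        using N A proj_works[OF ds, of h] by (blast intro: subspace_diff)
      then have "(h - ?A (?P h)) - ?P h \<in> N" by (simp add: algebra_simps)
      ultimately have "(h - ?A (?P h)) - ?P h = 0" using FN by blast
      then have "h = ?P h + ?A (?P h)" by (simp add: algebra_simps)
      then show "h \<in> {e + ?A e |e. e \<in> F}" using proj_works[OF ds, of h] by blast
    next
      fix h assume "h \<in> {e + ?A e |e. e \<in> F}"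
      then obtain e where e: "e \<in> F" "h = e + ?A e" by blast
      then have "?P h = e" using A proj_on_range[OF ds] proj_on_kernel[OF ds] by (simp add: P.add)
      then show "h \<in> {h. h - ?A (?P h) \<in> F}" using e by simp
    qed
    also have "\<dots> = M y"
      using alpha_graph[of M x0 N y] ds cot y by (auto simp: S_def cotailed_def F_def)
    finally show ?thesis .
  qed
  ultimately show ?thesis unfolding C1_integrable_at_def by blast
qed

section \<open>Integrability and the differential equation\<close>

theorem theorem2p2:
  fixes \<Lambda> :: "'a::banach set" and x0 :: 'a and M :: "'a \<Rightarrow> 'a set"
  assumes "open \<Lambda>" and "x0 \<in> \<Lambda>" and "\<And>x. x \<in> \<Lambda> \<Longrightarrow> subspace (M x)"
  shows
    "(C1_integrable_at M \<Lambda> x0 \<longrightarrow>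
        splitting (M x0) \<and>
        (\<forall>N. direct_sum (M x0) N \<longrightarrow>
           (\<exists>V \<psi>. openin (top_of_set (M x0)) V \<and> proj (M x0) N x0 \<in> V \<and>
              \<psi> \<in> C1_maps (M x0) V N \<and>
              {x + \<psi> x | x. x \<in> V} \<subseteq> cotailed M \<Lambda> N \<and>
              (\<forall>x\<in>V. has_derivative_rel (M x0) N \<psi> (alpha M x0 N (x + \<psi> x)) x) \<and>
              \<psi> (proj (M x0) N x0) = proj N (M x0) x0))) \<and>
     (splitting (M x0) \<and>
        (\<exists>N. direct_sum (M x0) N \<and>
           (\<exists>V \<psi>. openin (top_of_set (M x0)) V \<and> proj (M x0) N x0 \<in> V \<and>
              \<psi> \<in> C1_maps (M x0) V N \<and>
              {x + \<psi> x | x. x \<in> V} \<subseteq> cotailed M \<Lambda> N \<and>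
              (\<forall>x\<in>V. has_derivative_rel (M x0) N \<psi> (alpha M x0 N (x + \<psi> x)) x) \<and>
              \<psi> (proj (M x0) N x0) = proj N (M x0) x0)) \<longrightarrow>
      C1_integrable_at M \<Lambda> x0)"
proof (intro conjI impI)
  assume "C1_integrable_at M \<Lambda> x0"
  then obtain S where S: "C1_submanifold S" "x0 \<in> S" "S \<subseteq> \<Lambda>"
    and TS: "\<And>x. x \<in> S \<Longrightarrow> tangent_space S x = M x"
    unfolding C1_integrable_at_def by blast
  show "splitting (M x0)" using tangent_space_splitting[OF S(1,2)] TS[OF S(2)] by simp
  show "\<forall>N. direct_sum (M x0) N \<longrightarrow>
           (\<exists>V \<psi>. openin (top_of_set (M x0)) V \<and> proj (M x0) N x0 \<in> V \<and>
              \<psi> \<in> C1_maps (M x0) V N \<and>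
              {x + \<psi> x | x. x \<in> V} \<subseteq> cotailed M \<Lambda> N \<and>
              (\<forall>x\<in>V. has_derivative_rel (M x0) N \<psi> (alpha M x0 N (x + \<psi> x)) x) \<and>
              \<psi> (proj (M x0) N x0) = proj N (M x0) x0)"
    by (intro allI impI integrable_imp_graph[OF S TS])
next
  assume "splitting (M x0) \<and>
        (\<exists>N. direct_sum (M x0) N \<and>
           (\<exists>V \<psi>. openin (top_of_set (M x0)) V \<and> proj (M x0) N x0 \<in> V \<and>
              \<psi> \<in> C1_maps (M x0) V N \<and>
              {x + \<psi> x | x. x \<in> V} \<subseteq> cotailed M \<Lambda> N \<and>
              (\<forall>x\<in>V. has_derivative_rel (M x0) N \<psi> (alpha M x0 N (x + \<psi> x)) x) \<and>
              \<psi> (proj (M x0) N x0) = proj N (M x0) x0))"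
  then obtain N V \<psi> where "direct_sum (M x0) N" "openin (top_of_set (M x0)) V"
      "proj (M x0) N x0 \<in> V" "\<psi> \<in> C1_maps (M x0) V N" "{x + \<psi> x | x. x \<in> V} \<subseteq> cotailed M \<Lambda> N"
      "\<forall>x\<in>V. has_derivative_rel (M x0) N \<psi> (alpha M x0 N (x + \<psi> x)) x"
      "\<psi> (proj (M x0) N x0) = proj N (M x0) x0"
    by (elim conjE exE) (rule that)
  then show "C1_integrable_at M \<Lambda> x0" by (intro graph_imp_integrable[where N = N and V = V and \<psi> = \<psi>]) auto
qed

end
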